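(* There is an absolute constant $C>0$ such that for every $\kappa\ge 1$ there exists a (deterministic) online algorithm for constrained convex function chasing that is $C\sqrt{\kappa}$-competitive on all instances (in every dimension $d$, for every convex action set $K\subseteq\mathbb{R}^d$ and every starting point $x_0\in K$) in which every request function $f_t$ has condition number at most $\kappa$.
   Context: Constrained convex function chasing (CFC/SOCO) in Euclidean space: a dimension $d\ge1$, a convex action set $K\subseteq\mathbb{R}^d$ and a starting point $x_0\in K$ are fixed. Non-negative, convex, differentiable functions $f_1,f_2,\dots,f_T:\mathbb{R}^d\to[0,\infty)$ arrive one at a time; after seeing $f_t$ (and only $f_1,\dots,f_t$) the online algorithm must choose $x_t\in K$. The cost of a sequence $X=(x_1,\dots,x_T)$ is $\mathrm{cost}(X)=\sum_{t=1}^T\big(\|x_t-x_{t-1}\|_2+f_t(x_t)\big)$. $OPT$ denotes the infimum of $\mathrm{cost}(Y)$ over all sequences $Y=(y_1,\dots,y_T)$ in $K$ with $y_0=x_0$ (chosen offline with knowledge of all functions). An algorithm is $c$-competitive if for every instance its cost is at most $c\cdot OPT$. A differentiable $f$ is $\alpha$-strongly convex if $f(y)-f(x)-\langle\nabla f(x),y-x\rangle\ge\frac{\alpha}{2}\|x-y\|_2^2$ for all $x,y$, and $\beta$-smooth if $f(y)-f(x)-\langle\nabla f(x),y-x\rangle\le\frac{\beta}{2}\|x-y\|_2^2$ for all $x,y$. $f$ has condition number at most $\kappa$ ($\kappa$-well-conditioned) if there is some $\alpha>0$ (which may differ from function to function) such that $f$ is $\alpha$-strongly convex and $\alpha\kappa$-smooth.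 *)

theory Defs
  imports Complex_Main "HOL-Library.FuncSet" "Jordan_Normal_Form.Matrix"
begin

text \<open>
  The constant in the theorem is uniform in the dimension, so the dimension is a number and not a
  type: \<open>\<real>\<^sup>d\<close> is \<^term>\<open>carrier_vec d :: real vec set\<close>.
\<close>

type_synonym point = "real vec"

type_synonym request = "point \<Rightarrow> real"

definition norm2 :: "point \<Rightarrow> real" where
  "norm2 v = sqrt (v \<bullet> v)"

definition convex_set :: "point set \<Rightarrow> bool" where
  "convex_set K \<longleftrightarrow>
    (\<forall>x\<in>K. \<forall>y\<in>K. \<forall>s\<in>{0..1}. (1 - s) \<cdot>\<^sub>v x + s \<cdot>\<^sub>v y \<in> K)"

definition convex_fun :: "nat \<Rightarrow> request \<Rightarrow> bool" where
  "convex_fun d f \<longleftrightarrow>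
    (\<forall>x\<in>carrier_vec d. \<forall>y\<in>carrier_vec d. \<forall>s\<in>{0..1}.
      f ((1 - s) \<cdot>\<^sub>v x + s \<cdot>\<^sub>v y) \<le> (1 - s) * f x + s * f y)"

definition has_gradient :: "nat \<Rightarrow> request \<Rightarrow> point \<Rightarrow> point \<Rightarrow> bool" where
  "has_gradient d f x g \<longleftrightarrow> g \<in> carrier_vec d \<and>
    (\<forall>\<epsilon>>0. \<exists>\<delta>>0. \<forall>y\<in>carrier_vec d. norm2 (y - x) < \<delta> \<longrightarrow>
      \<bar>f y - f x - g \<bullet> (y - x)\<bar> \<le> \<epsilon> * norm2 (y - x))"

definition gradient :: "nat \<Rightarrow> request \<Rightarrow> point \<Rightarrow> point" where
  "gradient d f x = (THE g. has_gradient d f x g)"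

definition differentiable_fun :: "nat \<Rightarrow> request \<Rightarrow> bool" where
  "differentiable_fun d f \<longleftrightarrow> (\<forall>x\<in>carrier_vec d. \<exists>g. has_gradient d f x g)"

definition strongly_convex :: "nat \<Rightarrow> real \<Rightarrow> request \<Rightarrow> bool" where
  "strongly_convex d \<alpha> f \<longleftrightarrow>
    (\<forall>x\<in>carrier_vec d. \<forall>y\<in>carrier_vec d.
      f y - f x - gradient d f x \<bullet> (y - x) \<ge> \<alpha> / 2 * (norm2 (x - y))\<^sup>2)"

definition smooth_fun :: "nat \<Rightarrow> real \<Rightarrow> request \<Rightarrow> bool" where
  "smooth_fun d \<beta> f \<longleftrightarrow>
    (\<forall>x\<in>carrier_vec d. \<forall>y\<in>carrier_vec d.
      f y - f x - gradient d f x \<bullet> (y - x) \<le> \<beta> / 2 * (norm2 (x - y))\<^sup>2)"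

definition well_conditioned :: "nat \<Rightarrow> real \<Rightarrow> request \<Rightarrow> bool" where
  "well_conditioned d \<kappa> f \<longleftrightarrow>
    (\<exists>\<alpha>>0. strongly_convex d \<alpha> f \<and> smooth_fun d (\<alpha> * \<kappa>) f)"

text \<open>
  Requests are extensional functions on \<open>\<real>\<^sup>d\<close>, so an algorithm receives nothing but
  the values on \<open>\<real>\<^sup>d\<close>.
\<close>

definition requests :: "nat \<Rightarrow> request set" where
  "requests d =
    {f \<in> carrier_vec d \<rightarrow>\<^sub>E {0..}. convex_fun d f \<and> differentiable_fun d f}"

definition cfc_instance :: "nat \<Rightarrow> point set \<Rightarrow> point \<Rightarrow> request list \<Rightarrow> bool" where
  "cfc_instance d K x\<^sub>0 fs \<longleftrightarrow>
    d \<ge> 1 \<and> K \<subseteq> carrier_vec d \<and> convex_set K \<and> x\<^sub>0 \<in> K \<and> set fs \<subseteq> requests d"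

text \<open>
  With 0-based lists, \<open>fs ! t\<close> and \<open>xs ! t\<close> are the request and the action of round
  \<open>t + 1\<close>, and \<open>(x\<^sub>0 # xs) ! t\<close> is the preceding action.
\<close>

definition cost :: "point \<Rightarrow> request list \<Rightarrow> point list \<Rightarrow> real" where
  "cost x\<^sub>0 fs xs =
    (\<Sum>t<length fs. norm2 (xs ! t - (x\<^sub>0 # xs) ! t) + (fs ! t) (xs ! t))"

definition OPT :: "point set \<Rightarrow> point \<Rightarrow> request list \<Rightarrow> real" where
  "OPT K x\<^sub>0 fs = Inf {cost x\<^sub>0 fs ys | ys. length ys = length fs \<and> set ys \<subseteq> K}"

text \<open>
  A deterministic online algorithm knows the dimension, the action set and the starting point, and
  maps the requests \<open>[f\<^sub>1, \<dots>, f\<^sub>t]\<close> seen so far to the action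
  \<open>x\<^sub>t\<close>; it knows neither the later requests nor their number.
\<close>

type_synonym algorithm = "nat \<Rightarrow> point set \<Rightarrow> point \<Rightarrow> request list \<Rightarrow> point"

definition actions ::
  "algorithm \<Rightarrow> nat \<Rightarrow> point set \<Rightarrow> point \<Rightarrow> request list \<Rightarrow> point list" where
  "actions A d K x\<^sub>0 fs = map (\<lambda>t. A d K x\<^sub>0 (take (Suc t) fs)) [0..<length fs]"

definition online_algorithm :: "algorithm \<Rightarrow> bool" where
  "online_algorithm A \<longleftrightarrow>
    (\<forall>d K x\<^sub>0 fs. cfc_instance d K x\<^sub>0 fs \<longrightarrow> set (actions A d K x\<^sub>0 fs) \<subseteq> K)"

definition competitive_on ::
  "(nat \<Rightarrow> point set \<Rightarrow> point \<Rightarrow> request list \<Rightarrow> bool) \<Rightarrow> real \<Rightarrow> algorithm \<Rightarrow> bool" where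
  "competitive_on \<I> c A \<longleftrightarrow>
    (\<forall>d K x\<^sub>0 fs. \<I> d K x\<^sub>0 fs \<longrightarrow>
      cost x\<^sub>0 fs (actions A d K x\<^sub>0 fs) \<le> c * OPT K x\<^sub>0 fs)"

definition well_conditioned_instance ::
  "real \<Rightarrow> nat \<Rightarrow> point set \<Rightarrow> point \<Rightarrow> request list \<Rightarrow> bool" where
  "well_conditioned_instance \<kappa> d K x\<^sub>0 fs \<longleftrightarrow>
    cfc_instance d K x\<^sub>0 fs \<and> (\<forall>f\<in>set fs. well_conditioned d \<kappa> f)"

lemma norm2_smult: "norm2 (s \<cdot>\<^sub>v v) = \<bar>s\<bar> * norm2 v"
proof -
  have "(s \<cdot>\<^sub>v v) \<bullet> (s \<cdot>\<^sub>v v) = s\<^sup>2 * (v \<bullet> v)"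
    by (simp add: scalar_prod_def sum_distrib_left power2_eq_square algebra_simps)
  then show ?thesis
    by (simp add: norm2_def real_sqrt_mult)
qed

lemma scalar_prod_self_nonneg: "v \<bullet> v \<ge> 0" for v :: point
  by (simp add: scalar_prod_def sum_nonneg)

lemma norm2_nonneg: "norm2 v \<ge> 0"
  by (simp add: norm2_def scalar_prod_self_nonneg)

lemma scalar_prod_self_eq_norm2: "v \<bullet> v = norm2 v * norm2 v"
  by (simp add: norm2_def scalar_prod_self_nonneg)

lemma has_gradient_unique:
  assumes x: "x \<in> carrier_vec d" and g: "has_gradient d f x g" and h: "has_gradient d f x h"
  shows "g = h"
proof (rule ccontr)
  assume "g \<noteq> h"
  have gd: "g \<in> carrier_vec d" and hd: "h \<in> carrier_vec d"
    using g h by (auto simp: has_gradient_def)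
  define w where "w = g - h"
  have w: "w \<in> carrier_vec d" using gd hd by (simp add: w_def)
  define r where "r = norm2 w"
  obtain i where i: "i < d" "g $ i \<noteq> h $ i"
    using \<open>g \<noteq> h\<close> gd hd by (metis carrier_vecD eq_vecI)
  have "w \<bullet> w = (\<Sum>j<d. (w $ j)\<^sup>2)"
    using w by (simp add: scalar_prod_def power2_eq_square atLeast0LessThan)
  also have "\<dots> > 0"
    using i gd hd by (intro sum_pos2[of _ i]) (auto simp: w_def)
  finally have r: "r > 0" by (simp add: r_def norm2_def)
  from g r obtain a where a: "a > 0" "\<And>y. y \<in> carrier_vec d \<Longrightarrow> norm2 (y - x) < a \<Longrightarrow>
      \<bar>f y - f x - g \<bullet> (y - x)\<bar> \<le> r / 4 * norm2 (y - x)"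
    unfolding has_gradient_def by (metis divide_pos_pos zero_less_numeral)
  from h r obtain b where b: "b > 0" "\<And>y. y \<in> carrier_vec d \<Longrightarrow> norm2 (y - x) < b \<Longrightarrow>
      \<bar>f y - f x - h \<bullet> (y - x)\<bar> \<le> r / 4 * norm2 (y - x)"
    unfolding has_gradient_def by (metis divide_pos_pos zero_less_numeral)
  define s where "s = min a b / (2 * r)"
  have s: "s > 0" using a b r by (simp add: s_def)
  define y where "y = x + s \<cdot>\<^sub>v w"
  have y: "y \<in> carrier_vec d" using x w by (simp add: y_def)
  have yx: "y - x = s \<cdot>\<^sub>v w" using x w by (auto simp: y_def)
  have n: "norm2 (y - x) = s * r" using s by (simp add: yx norm2_smult r_def)
  have lt: "s * r < a" "s * r < b" using a b r by (auto simp: s_def)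
  have "g \<bullet> (y - x) - h \<bullet> (y - x) = w \<bullet> (y - x)"
    using gd hd y x by (simp add: w_def minus_scalar_prod_distrib[of _ d])
  also have "\<dots> = s * (r * r)"
    using w by (simp add: yx r_def scalar_prod_self_eq_norm2)
  finally have eq: "g \<bullet> (y - x) - h \<bullet> (y - x) = s * (r * r)" .
  have "s * (r * r) \<le> r / 4 * (s * r) + r / 4 * (s * r)"
    using a(2)[OF y] b(2)[OF y] lt eq unfolding n by linarith
  moreover have "s * (r * r) > 0" using s r by simp
  ultimately show False by (simp add: algebra_simps)
qed

lemma has_gradient_gradient:
  assumes "differentiable_fun d f" "x \<in> carrier_vec d"
  shows "has_gradient d f x (gradient d f x)"
  using assms has_gradient_unique unfolding differentiable_fun_def gradient_def
  by (metis (no_types, lifting) theI')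

end

theory Submission
  imports Defs "HOL-Analysis.Convex"
begin

text \<open>
  From \<open>p\<close>, on a request \<open>f\<close>, move to the minimizer \<open>x\<close> over \<open>u \<in> K\<close> of
  \<open>(norm2 (u - p))\<^sup>2 / 2 + f u powr (3/2) / (6 * \<sigma>)\<close>, where \<open>\<sigma> = sqrt (\<alpha> * \<kappa> / 2)\<close> is a Lipschitz
  constant of \<open>sqrt f\<close>, by smoothness and non-negativity. The exponent balances the two costs: the
  gradient of the second term has norm at most \<open>f / 2\<close>, so the movement is \<open>O(f x)\<close>. If the offline
  position \<open>y\<close> has \<open>f y \<le> f x / 4\<close>, then \<open>(x - p) \<bullet> (y - x)\<close> is at least of order
  \<open>f x powr (3/2) / \<sigma>\<close> by the variational inequality for \<open>x\<close>, while
  \<open>norm2 (x - y) \<le> 3 * sqrt (f x / \<alpha>)\<close> by strong convexity. Hence the distance to \<open>y\<close> decreases by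
  at least the order of \<open>f x * sqrt \<alpha> / \<sigma>\<close>, that is, of \<open>f x / sqrt \<kappa>\<close>, and a multiple of \<open>sqrt \<kappa>\<close>
  times the distance to the offline position is a potential that pays for the step. If
  \<open>f y > f x / 4\<close>, the offline cost pays. As \<open>K\<close> need not be closed, the minimizer may fail to
  exist, and near-minimizers take its place.
\<close>

lemma norm2_power2: "(norm2 v)\<^sup>2 = v \<bullet> v"
  by (simp add: scalar_prod_self_eq_norm2 power2_eq_square)

lemma norm2_add_power2:
  assumes "a \<in> carrier_vec d" "b \<in> carrier_vec d"
  shows "(norm2 (a + b))\<^sup>2 = (norm2 a)\<^sup>2 + 2 * (a \<bullet> b) + (norm2 b)\<^sup>2"
  using assms comm_scalar_prod[OF assms]
  by (simp add: norm2_power2 scalar_prod_add_distrib[of _ d] add_scalar_prod_distrib[of _ d])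

lemma norm2_uminus: "norm2 (- v) = norm2 v"
  by (simp add: norm2_def scalar_prod_def)

lemma norm2_minus_commute:
  assumes "a \<in> carrier_vec d" "b \<in> carrier_vec d"
  shows "norm2 (a - b) = norm2 (b - a)"
proof -
  have "a - b = - (b - a)" using assms by auto
  then show ?thesis by (simp only: norm2_uminus)
qed

lemma norm2_eq_L2_set:
  assumes "a \<in> carrier_vec d"
  shows "norm2 a = L2_set (($) a) {..<d}"
  using assms
  by (simp add: norm2_def L2_set_def scalar_prod_def atLeast0LessThan power2_eq_square)

lemma scalar_prod_le_norm2:
  assumes a: "a \<in> carrier_vec d" and b: "b \<in> carrier_vec d"
  shows "a \<bullet> b \<le> norm2 a * norm2 b"
proof -
  have "a \<bullet> b \<le> (\<Sum>i<d. \<bar>a $ i\<bar> * \<bar>b $ i\<bar>)"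
    using b by (simp add: scalar_prod_def atLeast0LessThan flip: abs_mult) (auto intro!: sum_mono)
  also have "\<dots> \<le> norm2 a * norm2 b"
    using L2_set_mult_ineq norm2_eq_L2_set[OF a] norm2_eq_L2_set[OF b] by metis
  finally show ?thesis .
qed

lemma norm2_triangle:
  assumes "a \<in> carrier_vec d" "b \<in> carrier_vec d"
  shows "norm2 (a + b) \<le> norm2 a + norm2 b"
proof (rule power2_le_imp_le)
  show "(norm2 (a + b))\<^sup>2 \<le> (norm2 a + norm2 b)\<^sup>2"
    using scalar_prod_le_norm2[OF assms] norm2_add_power2[OF assms] by (simp add: power2_sum)
qed (simp add: norm2_nonneg)

lemma norm2_diff_triangle:
  assumes "x \<in> carrier_vec d" "y \<in> carrier_vec d" "z \<in> carrier_vec d"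
  shows "norm2 (x - z) \<le> norm2 (x - y) + norm2 (y - z)"
proof -
  have "x - z = (x - y) + (y - z)" using assms by auto
  then show ?thesis using norm2_triangle[of "x - y" d "y - z"] assms by simp
qed

lemma norm2_diff_self: "x \<in> carrier_vec d \<Longrightarrow> norm2 (x - x) = 0"
  by (simp add: norm2_def)

lemma scalar_prod_le_norm2_mult_decrease:
  assumes "p \<in> carrier_vec d" "x \<in> carrier_vec d" "y \<in> carrier_vec d"
  shows "(x - p) \<bullet> (y - x) \<le> norm2 (y - x) * (norm2 (p - y) - norm2 (x - y))"
proof -
  have "p - y = (p - x) + (x - y)" using assms by auto
  then have "(p - y) \<bullet> (x - y) = (p - x) \<bullet> (x - y) + (norm2 (x - y))\<^sup>2"
    using assms by (simp add: add_scalar_prod_distrib[of _ d] norm2_power2)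
  moreover have "x - p = - (p - x)" "y - x = - (x - y)" using assms by auto
  ultimately have "(x - p) \<bullet> (y - x) = (p - y) \<bullet> (x - y) - (norm2 (x - y))\<^sup>2"
    using assms by simp
  also have "\<dots> \<le> norm2 (p - y) * norm2 (x - y) - (norm2 (x - y))\<^sup>2"
    using scalar_prod_le_norm2[of "p - y" d "x - y"] assms by simp
  also have "\<dots> = norm2 (y - x) * (norm2 (p - y) - norm2 (x - y))"
    using norm2_minus_commute[OF assms(2,3)] by (simp add: power2_eq_square algebra_simps)
  finally show ?thesis .
qed

lemma gradient_carrier:
  assumes "differentiable_fun d f" "x \<in> carrier_vec d"
  shows "gradient d f x \<in> carrier_vec d"
  using has_gradient_gradient[OF assms] by (simp add: has_gradient_def)

lemma norm2_gradient_power2_le: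
  assumes \<beta>: "\<beta> > 0" and smooth: "smooth_fun d \<beta> f" and diff: "differentiable_fun d f"
    and nonneg: "\<And>u. u \<in> carrier_vec d \<Longrightarrow> f u \<ge> 0" and x: "x \<in> carrier_vec d"
  shows "(norm2 (gradient d f x))\<^sup>2 \<le> 2 * \<beta> * f x"
proof -
  define g where "g = gradient d f x"
  have g: "g \<in> carrier_vec d" using gradient_carrier[OF diff x] by (simp add: g_def)
  define y where "y = x - (1 / \<beta>) \<cdot>\<^sub>v g"
  have y: "y \<in> carrier_vec d" using x g by (simp add: y_def)
  have yx: "y - x = (- 1 / \<beta>) \<cdot>\<^sub>v g" and xy: "x - y = (1 / \<beta>) \<cdot>\<^sub>v g"
    using x g by (auto simp: y_def)
  have "f y - f x - g \<bullet> (y - x) \<le> \<beta> / 2 * (norm2 (x - y))\<^sup>2"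
    using smooth x y by (simp add: smooth_fun_def g_def)
  moreover have "g \<bullet> (y - x) = - (norm2 g)\<^sup>2 / \<beta>"
    using g by (simp add: yx norm2_power2)
  moreover have "(norm2 (x - y))\<^sup>2 = (norm2 g)\<^sup>2 / \<beta>\<^sup>2"
    by (simp add: xy norm2_smult power_divide)
  ultimately have "f y - f x + (norm2 g)\<^sup>2 / \<beta> \<le> (norm2 g)\<^sup>2 / (2 * \<beta>)"
    using \<beta> by (simp add: power2_eq_square)
  with nonneg[OF y] have "(norm2 g)\<^sup>2 / \<beta> - (norm2 g)\<^sup>2 / (2 * \<beta>) \<le> f x" by linarith
  then have "(norm2 g)\<^sup>2 / (2 * \<beta>) \<le> f x" by (simp add: field_simps)
  then show ?thesis using \<beta> by (simp add: g_def field_simps)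
qed

definition norm2_lipschitz_on :: "real \<Rightarrow> point set \<Rightarrow> (point \<Rightarrow> real) \<Rightarrow> bool" where
  "norm2_lipschitz_on L S h \<longleftrightarrow> (\<forall>x\<in>S. \<forall>y\<in>S. h y \<le> h x + L * norm2 (y - x))"

lemma norm2_lipschitz_onD:
  "norm2_lipschitz_on L S h \<Longrightarrow> x \<in> S \<Longrightarrow> y \<in> S \<Longrightarrow> h y \<le> h x + L * norm2 (y - x)"
  by (simp add: norm2_lipschitz_on_def)

lemma norm2_lipschitz_on_sqrt_smooth:
  assumes \<beta>: "\<beta> > 0" and smooth: "smooth_fun d \<beta> f" and diff: "differentiable_fun d f"
    and nonneg: "\<And>u. u \<in> carrier_vec d \<Longrightarrow> f u \<ge> 0"
  shows "norm2_lipschitz_on (sqrt (\<beta> / 2)) (carrier_vec d) (\<lambda>u. sqrt (f u))"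
  unfolding norm2_lipschitz_on_def
proof (intro ballI real_le_lsqrt)
  fix x y :: point
  assume x: "x \<in> carrier_vec d" and y: "y \<in> carrier_vec d"
  define g where "g = gradient d f x"
  define n where "n = norm2 (y - x)"
  have n: "n \<ge> 0" by (simp add: n_def norm2_nonneg)
  have g: "g \<in> carrier_vec d" using gradient_carrier[OF diff x] by (simp add: g_def)
  have "norm2 g \<le> sqrt (2 * \<beta> * f x)"
    using norm2_gradient_power2_le[OF \<beta> smooth diff nonneg x]
    by (simp add: g_def real_le_rsqrt)
  also have "\<dots> = sqrt (4 * ((\<beta> / 2) * f x))" by simp
  also have "\<dots> = 2 * (sqrt (\<beta> / 2) * sqrt (f x))" by (simp only: real_sqrt_mult) simp
  finally have norm_g: "norm2 g \<le> 2 * (sqrt (\<beta> / 2) * sqrt (f x))" .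
  have "f y \<le> f x + g \<bullet> (y - x) + \<beta> / 2 * n\<^sup>2"
    using smooth x y norm2_minus_commute[OF x y] by (fastforce simp: smooth_fun_def g_def n_def)
  also have "g \<bullet> (y - x) \<le> norm2 g * n"
    using scalar_prod_le_norm2[of g d "y - x"] g x y by (simp add: n_def)
  also have "norm2 g * n \<le> 2 * (sqrt (\<beta> / 2) * sqrt (f x)) * n"
    by (rule mult_right_mono[OF norm_g n])
  finally have "f y \<le> f x + 2 * (sqrt (\<beta> / 2) * sqrt (f x)) * n + \<beta> / 2 * n\<^sup>2" by simp
  also have "\<dots> = (sqrt (f x) + sqrt (\<beta> / 2) * n)\<^sup>2"
    using nonneg[OF x] \<beta> by (simp add: power2_sum power_mult_distrib)
  finally show "f y \<le> (sqrt (f x) + sqrt (\<beta> / 2) * norm2 (y - x))\<^sup>2" by (simp add: n_def)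
  show "0 \<le> sqrt (f x) + sqrt (\<beta> / 2) * norm2 (y - x)"
    using \<beta> nonneg[OF x] by (simp add: norm2_nonneg)
qed

lemma strongly_convex_dist_power2_le:
  assumes sc: "strongly_convex d \<alpha> f" and diff: "differentiable_fun d f"
    and nonneg: "\<And>u. u \<in> carrier_vec d \<Longrightarrow> f u \<ge> 0"
    and x: "x \<in> carrier_vec d" and y: "y \<in> carrier_vec d"
  shows "\<alpha> * (norm2 (y - x))\<^sup>2 \<le> 4 * (f x + f y)"
proof -
  define v where "v = (1/2) \<cdot>\<^sub>v (y - x)"
  define m where "m = x + v"
  have v: "v \<in> carrier_vec d" using x y by (simp add: v_def)
  have m: "m \<in> carrier_vec d" using x v by (simp add: m_def)
  define g where "g = gradient d f m"
  have g: "g \<in> carrier_vec d" using gradient_carrier[OF diff m] by (simp add: g_def)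
  have midpoint: "x - m = - v" "m - x = v" "y - m = v" "m - y = - v"
    using x y by (auto simp: m_def v_def field_simps)
  have "f x - f m - g \<bullet> (- v) \<ge> \<alpha> / 2 * (norm2 v)\<^sup>2"
    using sc m x by (fastforce simp: strongly_convex_def g_def midpoint)
  moreover have "f y - f m - g \<bullet> v \<ge> \<alpha> / 2 * (norm2 (- v))\<^sup>2"
    using sc m y by (fastforce simp: strongly_convex_def g_def midpoint)
  ultimately have "f x + f y - 2 * f m \<ge> \<alpha> * (norm2 v)\<^sup>2"
    using g v by (simp add: norm2_uminus)
  moreover have "(norm2 v)\<^sup>2 = (norm2 (y - x))\<^sup>2 / 4"
    by (simp add: v_def norm2_smult power_mult_distrib power_divide)
  ultimately show ?thesis using nonneg[OF m] by simp
qed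

lemma convex_on_sqrt_power3: "convex_on {0..} (\<lambda>x::real. sqrt x ^ 3)"
proof (rule convex_onI)
  fix t a b :: real
  assume t: "0 < t" "t < 1" and a: "a \<in> {0..}" and b: "b \<in> {0..}"
  define z where "z = (1 - t) * a + t * b"
  have z: "z \<ge> 0" using t a b by (simp add: z_def)
  have tangent: "sqrt z ^ 3 + 3 / 2 * sqrt z * (c - z) \<le> sqrt c ^ 3" if "c \<ge> 0" for c
  proof -
    have "v ^ 3 - (w ^ 3 + 3 / 2 * w * (v\<^sup>2 - w\<^sup>2)) = (v - w)\<^sup>2 * (v + w / 2)" for v w :: real
      by (simp add: power2_eq_square power3_eq_cube field_simps)
    from this[of "sqrt c" "sqrt z"]
    have "sqrt c ^ 3 - (sqrt z ^ 3 + 3 / 2 * sqrt z * (c - z))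
        = (sqrt c - sqrt z)\<^sup>2 * (sqrt c + sqrt z / 2)"
      using z that by simp
    also have "\<dots> \<ge> 0" using z that by simp
    finally show ?thesis by simp
  qed
  have "v = (1 - t) * (v + w * (a - z)) + t * (v + w * (b - z))" for v w
    by (simp add: z_def algebra_simps)
  then have "sqrt z ^ 3 = (1 - t) * (sqrt z ^ 3 + 3 / 2 * sqrt z * (a - z))
      + t * (sqrt z ^ 3 + 3 / 2 * sqrt z * (b - z))" .
  also have "\<dots> \<le> (1 - t) * sqrt a ^ 3 + t * sqrt b ^ 3"
    using t a b by (intro add_mono mult_left_mono tangent) simp_all
  finally show "sqrt ((1 - t) *\<^sub>R a + t *\<^sub>R b) ^ 3 \<le> (1 - t) * sqrt a ^ 3 + t * sqrt b ^ 3"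
    by (simp add: z_def)
qed simp

lemma convex_fun_compose:
  assumes f: "convex_fun d f" "\<And>u. u \<in> carrier_vec d \<Longrightarrow> f u \<in> S"
    and \<phi>: "convex_on S \<phi>" "mono_on S \<phi>"
  shows "convex_fun d (\<lambda>u. \<phi> (f u))"
  unfolding convex_fun_def
proof (intro ballI)
  fix x y :: point and s :: real
  assume x: "x \<in> carrier_vec d" and y: "y \<in> carrier_vec d" and s: "s \<in> {0..1}"
  have "(1 - s) *\<^sub>R f x + s *\<^sub>R f y \<in> S"
    using convex_on_imp_convex[OF \<phi>(1)] f(2)[OF x] f(2)[OF y] s by (simp add: convex_alt)
  then have "\<phi> (f ((1 - s) \<cdot>\<^sub>v x + s \<cdot>\<^sub>v y)) \<le> \<phi> ((1 - s) *\<^sub>R f x + s *\<^sub>R f y)"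
    using f x y s by (intro mono_onD[OF \<phi>(2)]) (simp_all add: convex_fun_def)
  also have "\<dots> \<le> (1 - s) * \<phi> (f x) + s * \<phi> (f y)"
    using f(2)[OF x] f(2)[OF y] s by (intro convex_onD[OF \<phi>(1)]) simp_all
  finally show "\<phi> (f ((1 - s) \<cdot>\<^sub>v x + s \<cdot>\<^sub>v y)) \<le> (1 - s) * \<phi> (f x) + s * \<phi> (f y)" .
qed

lemma convex_fun_sqrt_power3:
  assumes "convex_fun d f" "\<And>u. u \<in> carrier_vec d \<Longrightarrow> f u \<ge> 0"
  shows "convex_fun d (\<lambda>u. sqrt (f u) ^ 3)"
proof (rule convex_fun_compose[OF assms(1) _ convex_on_sqrt_power3])
  show "mono_on {0..} (\<lambda>x::real. sqrt x ^ 3)" by (auto intro!: mono_onI power_mono)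
qed (use assms(2) in simp)

lemma convex_fun_divide:
  assumes "convex_fun d g" "c \<ge> 0"
  shows "convex_fun d (\<lambda>u. g u / c)"
  unfolding convex_fun_def
proof (intro ballI)
  fix x y :: point and s :: real
  assume "x \<in> carrier_vec d" "y \<in> carrier_vec d" "s \<in> {0..1}"
  then have "g ((1 - s) \<cdot>\<^sub>v x + s \<cdot>\<^sub>v y) / c \<le> ((1 - s) * g x + s * g y) / c"
    using assms by (intro divide_right_mono) (simp_all add: convex_fun_def)
  then show "g ((1 - s) \<cdot>\<^sub>v x + s \<cdot>\<^sub>v y) / c \<le> (1 - s) * (g x / c) + s * (g y / c)"
    by (simp add: add_divide_distrib)
qed

lemma power3_add_diff_le:
  fixes a v :: real
  assumes "a \<ge> 0" "v \<ge> 0"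
  shows "(a + v) ^ 3 - a ^ 3 \<le> 6 * v * (a\<^sup>2 + v\<^sup>2)"
proof -
  have "(a + v) ^ 3 - a ^ 3 \<le> 3 * v * (a + v)\<^sup>2"
    using assms by (simp add: power2_eq_square power3_eq_cube algebra_simps)
  also have "\<dots> \<le> 3 * v * (2 * (a\<^sup>2 + v\<^sup>2))"
    using sum_squares_bound[of a v] assms by (intro mult_left_mono) (simp_all add: power2_sum)
  finally show ?thesis by (simp add: algebra_simps)
qed

lemma exists_pos_add_mult_power2_less:
  fixes a e :: real
  assumes "a \<ge> 0" "e > 0"
  obtains m where "m > 0" "m + a * m\<^sup>2 < e"
proof
  define m where "m = min 1 (e / (2 * (1 + a)))"
  show m: "m > 0" using assms by (simp add: m_def)
  have "m \<le> 1" by (simp add: m_def)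
  then have "m\<^sup>2 \<le> m" using m by (simp add: power2_eq_square mult_left_le)
  then have "m + a * m\<^sup>2 \<le> m + a * m" using assms by (intro add_left_mono mult_left_mono) simp_all
  also have "\<dots> = (1 + a) * m" by (simp add: algebra_simps)
  also have "\<dots> \<le> (1 + a) * (e / (2 * (1 + a)))"
    using assms by (intro mult_left_mono) (simp_all add: m_def)
  also have "\<dots> < e" using assms by (simp add: field_simps add_pos_nonneg)
  finally show "m + a * m\<^sup>2 < e" .
qed

lemma dist_decrease_ge:
  assumes carrier: "p \<in> carrier_vec d" "x \<in> carrier_vec d" "y \<in> carrier_vec d"
    and \<alpha>: "\<alpha> > 0" and \<sigma>: "0 < \<sigma>" "\<sigma> \<le> sqrt (\<alpha> * \<kappa>)" and a: "a > 0" and b: "0 \<le> b" "b \<le> a / 2"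
    and dist: "\<alpha> * (norm2 (y - x))\<^sup>2 \<le> 9 * a\<^sup>2"
    and variational: "(a ^ 3 - b ^ 3) / (6 * \<sigma>)
      \<le> (x - p) \<bullet> (y - x) + 1 / (16 * \<sigma> * (1 + 9 / \<alpha>)) * a * (a\<^sup>2 + (norm2 (y - x))\<^sup>2)"
  shows "a\<^sup>2 \<le> 36 * sqrt \<kappa> * (norm2 (p - y) - norm2 (x - y))"
proof -
  define D where "D = norm2 (y - x)"
  define \<Delta> where "\<Delta> = norm2 (p - y) - norm2 (x - y)"
  have D_power2: "D\<^sup>2 \<le> 9 / \<alpha> * a\<^sup>2" using dist \<alpha> by (simp add: D_def field_simps)
  have D: "D \<le> 3 * a / sqrt \<alpha>"
    by (rule power2_le_imp_le) (use a \<alpha> D_power2 in \<open>simp_all add: power_divide power_mult_distrib\<close>)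
  have "1 / (16 * \<sigma> * (1 + 9 / \<alpha>)) * a * (a\<^sup>2 + D\<^sup>2)
      \<le> 1 / (16 * \<sigma> * (1 + 9 / \<alpha>)) * a * ((1 + 9 / \<alpha>) * a\<^sup>2)"
    using D_power2 a \<alpha> \<sigma> by (intro mult_left_mono) (simp_all add: algebra_simps)
  also have "\<dots> = a ^ 3 / (16 * \<sigma>)"
    using \<alpha> \<sigma> add_pos_pos[of 1 "9 / \<alpha>"] by (simp add: power2_eq_square power3_eq_cube)
  finally have "(a ^ 3 - b ^ 3) / (6 * \<sigma>) \<le> (x - p) \<bullet> (y - x) + a ^ 3 / (16 * \<sigma>)"
    using variational unfolding D_def by linarith
  moreover have "7 / 8 * a ^ 3 / (6 * \<sigma>) \<le> (a ^ 3 - b ^ 3) / (6 * \<sigma>)"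
    using power_mono[OF b(2,1), of 3] \<sigma> by (intro divide_right_mono) (simp_all add: power_divide)
  moreover have "a ^ 3 / (12 * \<sigma>) = 7 / 8 * a ^ 3 / (6 * \<sigma>) - a ^ 3 / (16 * \<sigma>)" by simp
  ultimately have "a ^ 3 / (12 * \<sigma>) \<le> (x - p) \<bullet> (y - x)" by linarith
  also have "\<dots> \<le> D * \<Delta>"
    unfolding D_def \<Delta>_def by (rule scalar_prod_le_norm2_mult_decrease[OF carrier])
  finally have product: "a ^ 3 / (12 * \<sigma>) \<le> D * \<Delta>" .
  then have "0 < D * \<Delta>" using a \<sigma> by (simp add: less_le_trans[OF _ product])
  then have \<Delta>: "\<Delta> > 0" using norm2_nonneg[of "y - x"] by (simp add: D_def zero_less_mult_iff)
  have "a ^ 3 / (12 * \<sigma>) \<le> 3 * a / sqrt \<alpha> * \<Delta>"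
    using product mult_right_mono[OF D, of \<Delta>] \<Delta> by linarith
  then have "a * (sqrt \<alpha> * a\<^sup>2) \<le> a * (36 * \<sigma> * \<Delta>)"
    using \<sigma> \<alpha> by (simp add: field_simps power2_eq_square power3_eq_cube)
  then have "sqrt \<alpha> * a\<^sup>2 \<le> 36 * \<sigma> * \<Delta>" using a by simp
  also have "\<dots> \<le> 36 * (sqrt \<alpha> * sqrt \<kappa>) * \<Delta>"
    using \<sigma>(2) \<Delta> by (simp add: real_sqrt_mult)
  finally show ?thesis using \<alpha> by (simp add: \<Delta>_def)
qed

text \<open>
  For \<open>\<eta> = 0\<close> this is the variational inequality characterizing the minimizer of
  \<open>(norm2 (u - p))\<^sup>2 / 2 + g u\<close> over a convex set \<open>K\<close>, for convex \<open>g\<close>.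
\<close>

definition approx_prox :: "real \<Rightarrow> point set \<Rightarrow> (point \<Rightarrow> real) \<Rightarrow> point \<Rightarrow> point \<Rightarrow> bool" where
  "approx_prox \<eta> K g p x \<longleftrightarrow> x \<in> K \<and>
    (\<forall>y\<in>K. g x - g y \<le> (x - p) \<bullet> (y - x) + \<eta> * (1 + (norm2 (y - x))\<^sup>2))"

lemma approx_proxD_scaled:
  assumes "approx_prox \<eta> K g p x" "y \<in> K" "\<eta> \<le> \<tau> * a" "\<eta> \<le> \<tau> * a ^ 3"
  shows "g x - g y \<le> (x - p) \<bullet> (y - x) + \<tau> * a * (a\<^sup>2 + (norm2 (y - x))\<^sup>2)"
proof -
  have "g x - g y \<le> (x - p) \<bullet> (y - x) + (\<eta> + \<eta> * (norm2 (y - x))\<^sup>2)"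
    using assms(1,2) by (simp add: approx_prox_def distrib_left)
  also have "\<eta> + \<eta> * (norm2 (y - x))\<^sup>2 \<le> \<tau> * a ^ 3 + \<tau> * a * (norm2 (y - x))\<^sup>2"
    using assms(3,4) by (intro add_mono mult_right_mono) simp_all
  finally show ?thesis by (simp add: algebra_simps power2_eq_square power3_eq_cube)
qed

definition amortized_step ::
  "real \<Rightarrow> real \<Rightarrow> point set \<Rightarrow> point \<Rightarrow> request \<Rightarrow> point \<Rightarrow> bool" where
  "amortized_step c C K p f x \<longleftrightarrow> x \<in> K \<and> (\<forall>y\<in>K.
    norm2 (x - p) + f x + c * norm2 (x - y) \<le> c * norm2 (p - y) + C * f y)"

locale convex_action_set =
  fixes d :: nat and K :: "point set"
  assumes subset_carrier: "K \<subseteq> carrier_vec d" and convex: "convex_set K"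
begin

lemma in_carrier [simp]: "x \<in> K \<Longrightarrow> x \<in> carrier_vec d"
  using subset_carrier by auto

lemma convex_combination_in:
  assumes "x \<in> K" "y \<in> K" "0 \<le> s" "s \<le> 1"
  shows "(1 - s) \<cdot>\<^sub>v x + s \<cdot>\<^sub>v y \<in> K"
  using convex assms by (simp add: convex_set_def)

lemma approx_prox_exists:
  assumes g: "convex_fun d g" "\<And>u. u \<in> K \<Longrightarrow> g u \<ge> 0" and p: "p \<in> K" and \<eta>: "\<eta> > 0"
  obtains x where "approx_prox \<eta> K g p x"
proof -
  define \<Phi> where "\<Phi> u = (norm2 (u - p))\<^sup>2 / 2 + g u" for u
  define s where "s = min 1 \<eta>"
  have s: "0 < s" "s \<le> 1" "s \<le> \<eta>" using \<eta> by (simp_all add: s_def)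
  have bdd: "bdd_below (\<Phi> ` K)" using g(2) by (intro bdd_belowI2[of _ 0]) (simp add: \<Phi>_def)
  have "\<exists>v\<in>\<Phi> ` K. v < Inf (\<Phi> ` K) + s * \<eta>"
    using p s \<eta> by (intro cInf_lessD) auto
  then obtain x where x: "x \<in> K" and "\<Phi> x < Inf (\<Phi> ` K) + s * \<eta>" by blast
  then have near_min: "\<Phi> x \<le> \<Phi> u + s * \<eta>" if "u \<in> K" for u
    using cInf_lower[OF imageI[OF that] bdd] by linarith
  have "g x - g y \<le> (x - p) \<bullet> (y - x) + \<eta> * (1 + (norm2 (y - x))\<^sup>2)" if y: "y \<in> K" for y
  proof -
    define u where "u = (1 - s) \<cdot>\<^sub>v x + s \<cdot>\<^sub>v y"
    have u: "u \<in> K" using convex_combination_in[OF x y] s by (simp add: u_def)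
    have carrier: "x \<in> carrier_vec d" "y \<in> carrier_vec d" "p \<in> carrier_vec d"
      using x y p by simp_all
    then have "u - p = (x - p) + s \<cdot>\<^sub>v (y - x)"
      by (auto simp: u_def algebra_simps)
    then have "(norm2 (u - p))\<^sup>2
        = (norm2 (x - p))\<^sup>2 + 2 * s * ((x - p) \<bullet> (y - x)) + s\<^sup>2 * (norm2 (y - x))\<^sup>2"
      using norm2_add_power2[of "x - p" d "s \<cdot>\<^sub>v (y - x)"] carrier
      by (simp add: norm2_smult power_mult_distrib)
    moreover have "g u \<le> (1 - s) * g x + s * g y"
      using g(1) x y s by (simp add: convex_fun_def u_def)
    ultimately have "s * (g x - g y)
        \<le> s * ((x - p) \<bullet> (y - x) + s / 2 * (norm2 (y - x))\<^sup>2 + \<eta>)"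
      using near_min[OF u] by (simp add: \<Phi>_def power2_eq_square field_simps)
    then have "g x - g y \<le> (x - p) \<bullet> (y - x) + s / 2 * (norm2 (y - x))\<^sup>2 + \<eta>"
      using s(1) by simp
    also have "s / 2 * (norm2 (y - x))\<^sup>2 \<le> \<eta> * (norm2 (y - x))\<^sup>2"
      using s by (intro mult_right_mono) simp_all
    finally show ?thesis by (simp add: algebra_simps)
  qed
  then show ?thesis using x that unfolding approx_prox_def by blast
qed

text \<open>Testing the variational inequality at distance \<open>\<delta>\<close> from \<open>x\<close> towards \<open>p\<close>.\<close>

lemma approx_prox_displacement_le:
  assumes prox: "approx_prox \<eta> K (\<lambda>u. h u ^ 3 / (6 * \<sigma>)) p x" and p: "p \<in> K"
    and nonneg: "\<And>u. u \<in> K \<Longrightarrow> h u \<ge> 0" and lipschitz: "norm2_lipschitz_on \<sigma> K h"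
    and \<sigma>: "\<sigma> > 0" and \<eta>: "0 \<le> \<eta>" "\<eta> \<le> 1" and \<delta>: "\<delta> > 0"
  shows "norm2 (x - p) \<le> (h x)\<^sup>2 + (\<delta> + \<sigma>\<^sup>2 * \<delta>\<^sup>2) + \<eta> / \<delta>"
proof (cases "norm2 (x - p) \<le> \<delta>")
  case True
  moreover have "0 \<le> (h x)\<^sup>2 + \<sigma>\<^sup>2 * \<delta>\<^sup>2 + \<eta> / \<delta>" using \<eta> \<delta> by simp
  ultimately show ?thesis by linarith
next
  case False
  define G where "G = norm2 (x - p)"
  define s where "s = \<delta> / G"
  have s: "0 \<le> s" "s \<le> 1" "s * G = \<delta>" using False \<delta> by (simp_all add: s_def G_def)
  have x: "x \<in> K" using prox by (simp add: approx_prox_def)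
  define u where "u = (1 - s) \<cdot>\<^sub>v x + s \<cdot>\<^sub>v p"
  have u: "u \<in> K" using convex_combination_in[OF x p] s by (simp add: u_def)
  have ux: "u - x = (- s) \<cdot>\<^sub>v (x - p)"
    using in_carrier[OF x] in_carrier[OF p] by (auto simp: u_def algebra_simps)
  have norm_ux: "norm2 (u - x) = \<delta>" using s by (simp add: ux norm2_smult G_def)
  have "(x - p) \<bullet> (u - x) = - (\<delta> * G)"
    using x p by (simp add: ux scalar_prod_self_eq_norm2 mult.assoc flip: s(3) G_def)
  moreover have "h x ^ 3 / (6 * \<sigma>) - h u ^ 3 / (6 * \<sigma>)
      \<le> (x - p) \<bullet> (u - x) + \<eta> * (1 + (norm2 (u - x))\<^sup>2)"
    using prox u by (simp add: approx_prox_def)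
  ultimately have "\<delta> * G \<le> (h u ^ 3 - h x ^ 3) / (6 * \<sigma>) + \<eta> * (1 + \<delta>\<^sup>2)"
    by (simp add: norm_ux diff_divide_distrib)
  also have "h u ^ 3 \<le> (h x + \<sigma> * \<delta>) ^ 3"
    using norm2_lipschitz_onD[OF lipschitz x u] nonneg[OF u]
    by (intro power_mono) (simp_all add: norm_ux)
  also have "(h x + \<sigma> * \<delta>) ^ 3 - h x ^ 3 \<le> 6 * \<sigma> * (\<delta> * ((h x)\<^sup>2 + \<sigma>\<^sup>2 * \<delta>\<^sup>2))"
    using power3_add_diff_le[of "h x" "\<sigma> * \<delta>"] nonneg[OF x] \<sigma> \<delta>
    by (simp add: power_mult_distrib mult_ac)
  finally have "\<delta> * G \<le> \<delta> * ((h x)\<^sup>2 + \<sigma>\<^sup>2 * \<delta>\<^sup>2) + \<eta> * (1 + \<delta>\<^sup>2)"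
    using \<sigma> by (simp add: divide_right_mono)
  also have "\<dots> \<le> \<delta> * ((h x)\<^sup>2 + \<sigma>\<^sup>2 * \<delta>\<^sup>2) + (\<eta> + \<delta>\<^sup>2)"
    using \<eta> mult_right_mono[of \<eta> 1 "\<delta>\<^sup>2"] by (simp add: algebra_simps)
  also have "\<dots> = \<delta> * ((h x)\<^sup>2 + (\<delta> + \<sigma>\<^sup>2 * \<delta>\<^sup>2) + \<eta> / \<delta>)"
    using \<delta> by (simp add: field_simps power2_eq_square)
  finally show ?thesis using \<delta> by (simp add: G_def)
qed

lemma value_ge_of_displacement_le:
  assumes p: "p \<in> K" and x: "x \<in> K" and nonneg: "h x \<ge> 0"
    and lipschitz: "norm2_lipschitz_on \<sigma> K h" and \<sigma>: "\<sigma> \<ge> 0"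
    and displacement: "norm2 (x - p) \<le> (h x)\<^sup>2 + m\<^sup>2" and h_p: "m + 2 * \<sigma> * m\<^sup>2 < h p"
  shows "m \<le> h x"
proof (rule ccontr)
  assume small: "\<not> m \<le> h x"
  then have "(h x)\<^sup>2 \<le> m\<^sup>2" using nonneg by (intro power_mono) simp_all
  then have "norm2 (p - x) \<le> 2 * m\<^sup>2"
    using displacement norm2_minus_commute[of p d x] p x by simp
  then have "\<sigma> * norm2 (p - x) \<le> \<sigma> * (2 * m\<^sup>2)" using \<sigma> by (rule mult_left_mono)
  then show False using norm2_lipschitz_onD[OF lipschitz x p] h_p small by simp
qed

lemma balanced_approx_prox_exists:
  assumes p: "p \<in> K" and nonneg: "\<And>u. u \<in> K \<Longrightarrow> h u \<ge> 0" and h_p: "h p > 0"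
    and lipschitz: "norm2_lipschitz_on \<sigma> K h" and convex_power3: "convex_fun d (\<lambda>u. h u ^ 3)"
    and \<sigma>: "\<sigma> > 0" and \<tau>: "\<tau> > 0"
  obtains x where "x \<in> K" "h x > 0" "norm2 (x - p) \<le> 2 * (h x)\<^sup>2"
    "\<And>y. y \<in> K \<Longrightarrow> (h x ^ 3 - h y ^ 3) / (6 * \<sigma>)
      \<le> (x - p) \<bullet> (y - x) + \<tau> * h x * ((h x)\<^sup>2 + (norm2 (y - x))\<^sup>2)"
proof -
  obtain m where m: "m > 0" "m + 2 * \<sigma> * m\<^sup>2 < h p"
    using exists_pos_add_mult_power2_less[of "2 * \<sigma>"] \<sigma> h_p by auto
  obtain \<delta> where \<delta>: "\<delta> > 0" "\<delta> + \<sigma>\<^sup>2 * \<delta>\<^sup>2 < m\<^sup>2 / 2"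
    using exists_pos_add_mult_power2_less[of "\<sigma>\<^sup>2" "m\<^sup>2 / 2"] m by auto
  define \<eta> where "\<eta> = Min {1, \<delta> * (m\<^sup>2 / 2), \<tau> * m, \<tau> * m ^ 3}"
  have \<eta>: "0 < \<eta>" "\<eta> \<le> 1" "\<eta> \<le> \<delta> * (m\<^sup>2 / 2)" "\<eta> \<le> \<tau> * m" "\<eta> \<le> \<tau> * m ^ 3"
    using m \<delta> \<tau> by (simp_all add: \<eta>_def)
  obtain x where prox: "approx_prox \<eta> K (\<lambda>u. h u ^ 3 / (6 * \<sigma>)) p x"
    using approx_prox_exists[OF convex_fun_divide[OF convex_power3] _ p \<eta>(1), of "6 * \<sigma>"] nonneg \<sigma>
    by auto
  have x: "x \<in> K" using prox by (simp add: approx_prox_def)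
  have "\<eta> / \<delta> \<le> m\<^sup>2 / 2" using \<eta>(3) \<delta>(1) by (simp add: divide_le_eq mult.commute)
  with approx_prox_displacement_le[OF prox p nonneg lipschitz \<sigma> _ \<eta>(2) \<delta>(1)] \<eta>(1) \<delta>(2)
  have displacement: "norm2 (x - p) \<le> (h x)\<^sup>2 + m\<^sup>2" by linarith
  have m_le: "m \<le> h x"
    using value_ge_of_displacement_le[OF p x nonneg[OF x] lipschitz _ displacement m(2)] \<sigma> by simp
  have "\<eta> \<le> \<tau> * h x"
    by (rule order.trans[OF \<eta>(4)]) (use m_le \<tau> in simp)
  moreover have "\<eta> \<le> \<tau> * h x ^ 3"
    by (rule order.trans[OF \<eta>(5)]) (use m_le m \<tau> in \<open>simp add: power_mono\<close>)
  ultimately have "(h x ^ 3 - h y ^ 3) / (6 * \<sigma>)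
      \<le> (x - p) \<bullet> (y - x) + \<tau> * h x * ((h x)\<^sup>2 + (norm2 (y - x))\<^sup>2)" if "y \<in> K" for y
    using approx_proxD_scaled[OF prox that] by (simp add: diff_divide_distrib)
  moreover have "norm2 (x - p) \<le> 2 * (h x)\<^sup>2"
    using displacement power_mono[OF m_le, of 2] m by simp
  moreover have "h x > 0" using m_le m by simp
  ultimately show ?thesis using that x by blast
qed

lemma balanced_step_exists:
  assumes \<alpha>: "\<alpha> > 0" and \<kappa>: "\<kappa> > 0"
    and sc: "strongly_convex d \<alpha> f" and smooth: "smooth_fun d (\<alpha> * \<kappa>) f"
    and f: "f \<in> requests d" and p: "p \<in> K" and fp: "f p > 0"
  obtains x where "x \<in> K" "norm2 (x - p) \<le> 2 * f x"
    "\<And>y. y \<in> K \<Longrightarrow> 4 * f y \<le> f x \<Longrightarrow> f x \<le> 36 * sqrt \<kappa> * (norm2 (p - y) - norm2 (x - y))"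
proof -
  define \<sigma> where "\<sigma> = sqrt (\<alpha> * \<kappa> / 2)"
  define \<tau> where "\<tau> = 1 / (16 * \<sigma> * (1 + 9 / \<alpha>))"
  define h where "h u = sqrt (f u)" for u
  have \<sigma>: "\<sigma> > 0" and \<tau>: "\<tau> > 0" using \<alpha> \<kappa> by (simp_all add: \<sigma>_def \<tau>_def add_pos_pos)
  have diff: "differentiable_fun d f" and cvx: "convex_fun d f"
    and nonneg: "\<And>u. u \<in> carrier_vec d \<Longrightarrow> f u \<ge> 0"
    using f by (auto simp: requests_def)
  have h_power2: "(h u)\<^sup>2 = f u" if "u \<in> K" for u using nonneg that by (simp add: h_def)
  have lipschitz: "norm2_lipschitz_on \<sigma> K h"
    using norm2_lipschitz_on_sqrt_smooth[OF _ smooth diff nonneg] \<alpha> \<kappa>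
    by (simp add: \<sigma>_def h_def norm2_lipschitz_on_def)
  have "convex_fun d (\<lambda>u. h u ^ 3)"
    unfolding h_def using cvx nonneg by (rule convex_fun_sqrt_power3)
  then obtain x where x: "x \<in> K" and h_pos: "h x > 0"
    and displacement: "norm2 (x - p) \<le> 2 * (h x)\<^sup>2"
    and variational: "\<And>y. y \<in> K \<Longrightarrow> (h x ^ 3 - h y ^ 3) / (6 * \<sigma>)
      \<le> (x - p) \<bullet> (y - x) + \<tau> * h x * ((h x)\<^sup>2 + (norm2 (y - x))\<^sup>2)"
    using balanced_approx_prox_exists[OF p _ _ lipschitz _ \<sigma> \<tau>] fp nonneg by (auto simp: h_def)
  have "f x \<le> 36 * sqrt \<kappa> * (norm2 (p - y) - norm2 (x - y))"
    if y: "y \<in> K" and fy: "4 * f y \<le> f x" for y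
  proof -
    have "h y \<ge> 0" "h y \<le> h x / 2"
      using nonneg[of y] y real_sqrt_le_mono[OF fy] by (simp_all add: h_def real_sqrt_mult)
    moreover have "\<alpha> * (norm2 (y - x))\<^sup>2 \<le> 9 * (h x)\<^sup>2"
      using strongly_convex_dist_power2_le[OF sc diff nonneg, of x y] x y fy nonneg[of x]
      by (simp add: h_power2)
    moreover have "\<sigma> \<le> sqrt (\<alpha> * \<kappa>)" using \<alpha> \<kappa> by (simp add: \<sigma>_def)
    ultimately have "(h x)\<^sup>2 \<le> 36 * sqrt \<kappa> * (norm2 (p - y) - norm2 (x - y))"
      using variational[OF y, unfolded \<tau>_def]
      by (intro dist_decrease_ge[OF in_carrier[OF p] in_carrier[OF x] in_carrier[OF y] \<alpha> \<sigma> _ h_pos])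
        simp_all
    then show ?thesis by (simp add: h_power2[OF x])
  qed
  with x displacement show ?thesis using that by (simp add: h_power2)
qed

lemma amortized_stepI:
  assumes p: "p \<in> K" and x: "x \<in> K" and nonneg: "\<And>u. u \<in> K \<Longrightarrow> f u \<ge> 0" and B: "B \<ge> 1"
    and displacement: "norm2 (x - p) \<le> 2 * f x"
    and decrease: "\<And>y. y \<in> K \<Longrightarrow> 4 * f y \<le> f x
      \<Longrightarrow> f x \<le> B * (norm2 (p - y) - norm2 (x - y))"
  shows "amortized_step (3 * B) (36 * B) K p f x"
  unfolding amortized_step_def
proof (intro conjI ballI x)
  fix y assume y: "y \<in> K"
  show "norm2 (x - p) + f x + 3 * B * norm2 (x - y) \<le> 3 * B * norm2 (p - y) + 36 * B * f y"
  proof (cases "4 * f y \<le> f x")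
    case True
    then have "3 * f x \<le> 3 * B * norm2 (p - y) - 3 * B * norm2 (x - y)"
      using decrease[OF y] by (simp add: algebra_simps)
    moreover have "0 \<le> 36 * B * f y" using B nonneg[OF y] by simp
    ultimately show ?thesis using displacement by linarith
  next
    case False
    have "norm2 (x - y) \<le> norm2 (p - y) + 2 * f x"
      using norm2_diff_triangle[of x d p y] x p y displacement by simp
    then have "3 * B * norm2 (x - y) \<le> 3 * B * (norm2 (p - y) + 2 * f x)"
      using B by (intro mult_left_mono) simp_all
    moreover have "f x \<le> B * f x" using mult_right_mono[OF B nonneg[OF x]] by simp
    moreover have "B * f x \<le> B * (4 * f y)"
      using False B by (intro mult_left_mono) simp_all
    ultimately show ?thesis using displacement by (simp add: algebra_simps)
  qed
qed

lemma amortized_step_exists: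
  assumes \<kappa>: "\<kappa> \<ge> 1" and f: "f \<in> requests d" and wc: "well_conditioned d \<kappa> f" and p: "p \<in> K"
  shows "\<exists>x. amortized_step (108 * sqrt \<kappa>) (1296 * sqrt \<kappa>) K p f x"
proof -
  have nonneg: "f u \<ge> 0" if "u \<in> K" for u using f that by (auto simp: requests_def)
  obtain x where "x \<in> K" "norm2 (x - p) \<le> 2 * f x"
    and "\<And>y. y \<in> K \<Longrightarrow> 4 * f y \<le> f x
      \<Longrightarrow> f x \<le> 36 * sqrt \<kappa> * (norm2 (p - y) - norm2 (x - y))"
  proof (cases "f p = 0")
    case True
    then show ?thesis using that[of p] p norm2_diff_self[of p d] by simp
  next
    case False
    then have "f p > 0" using nonneg[OF p] by simp
    moreover obtain \<alpha> where "\<alpha> > 0" "strongly_convex d \<alpha> f" "smooth_fun d (\<alpha> * \<kappa>) f"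
      using wc by (auto simp: well_conditioned_def)
    ultimately show ?thesis
      using balanced_step_exists[of \<alpha> \<kappa> f p] \<kappa> f p that by auto
  qed
  moreover have "36 * sqrt \<kappa> \<ge> 1" using real_sqrt_ge_one[OF \<kappa>] by linarith
  ultimately have "amortized_step (3 * (36 * sqrt \<kappa>)) (36 * (36 * sqrt \<kappa>)) K p f x"
    using p nonneg by (intro amortized_stepI) simp_all
  then show ?thesis by auto
qed

end

text \<open>
  The algorithm takes any amortized step: proximal points only show that one exists. None need exist
  for ill-conditioned requests, where the algorithm still has to stay in \<open>K\<close>.
\<close>

definition amortized_move :: "real \<Rightarrow> real \<Rightarrow> point set \<Rightarrow> point \<Rightarrow> request \<Rightarrow> point" where
  "amortized_move c C K p f =
    (if \<exists>x. amortized_step c C K p f x then SOME x. amortized_step c C K p f x else p)"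

definition amortized_alg :: "real \<Rightarrow> real \<Rightarrow> algorithm" where
  "amortized_alg c C d K x\<^sub>0 fs = foldl (amortized_move c C K) x\<^sub>0 fs"

lemma amortized_step_amortized_move:
  "\<exists>x. amortized_step c C K p f x \<Longrightarrow> amortized_step c C K p f (amortized_move c C K p f)"
  unfolding amortized_move_def by (simp add: someI_ex)

lemma amortized_move_in: "p \<in> K \<Longrightarrow> amortized_move c C K p f \<in> K"
  using amortized_step_amortized_move[of c C K p f]
  by (metis amortized_step_def amortized_move_def)

lemma foldl_amortized_move_in: "p \<in> K \<Longrightarrow> foldl (amortized_move c C K) p fs \<in> K"
  by (induction fs arbitrary: p) (simp_all add: amortized_move_in)

lemma online_algorithm_amortized_alg: "online_algorithm (amortized_alg c C)"
  by (auto simp: online_algorithm_def actions_def amortized_alg_def cfc_instance_def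
      intro: foldl_amortized_move_in)

lemma actions_amortized_alg_Cons:
  "actions (amortized_alg c C) d K p (f # fs)
    = amortized_move c C K p f # actions (amortized_alg c C) d K (amortized_move c C K p f) fs"
  unfolding actions_def length_Cons
  by (simp only: map_upt_Suc) (simp add: amortized_alg_def)

lemma cost_Cons:
  "cost p (f # fs) (x # xs) = norm2 (x - p) + f x + cost x fs xs"
  by (simp only: cost_def length_Cons sum.lessThan_Suc_shift) simp

lemma cost_amortized_alg_le:
  assumes K: "K \<subseteq> carrier_vec d" and c: "0 \<le> c" "c \<le> C"
    and "\<And>p f. p \<in> K \<Longrightarrow> f \<in> set fs \<Longrightarrow> \<exists>x. amortized_step c C K p f x"
    and "p \<in> K" "q \<in> K" "length ys = length fs" "set ys \<subseteq> K"
  shows "cost p fs (actions (amortized_alg c C) d K p fs) \<le> c * norm2 (p - q) + C * cost q fs ys"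
  using assms(4-)
proof (induction fs arbitrary: p q ys)
  case Nil
  then show ?case using c by (simp add: cost_def norm2_nonneg)
next
  case (Cons f fs)
  then obtain y ys' where ys: "ys = y # ys'" by (cases ys) auto
  define x where "x = amortized_move c C K p f"
  have y: "y \<in> K" using Cons.prems ys by simp
  have x: "x \<in> K" using Cons.prems amortized_move_in by (simp add: x_def)
  have "amortized_step c C K p f x"
    unfolding x_def using Cons.prems by (intro amortized_step_amortized_move) simp
  then have "norm2 (x - p) + f x + c * norm2 (x - y) \<le> c * norm2 (p - y) + C * f y"
    using y by (simp add: amortized_step_def)
  moreover have "cost x fs (actions (amortized_alg c C) d K x fs)
      \<le> c * norm2 (x - y) + C * cost y fs ys'"
    using Cons.prems ys x y by (intro Cons.IH) simp_all
  moreover have "c * norm2 (p - y) \<le> c * norm2 (p - q) + C * norm2 (y - q)"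
  proof -
    have in_carrier: "p \<in> carrier_vec d" "q \<in> carrier_vec d" "y \<in> carrier_vec d"
      using Cons.prems y K by auto
    have "c * norm2 (p - y) \<le> c * norm2 (p - q) + c * norm2 (y - q)"
      using mult_left_mono[OF norm2_diff_triangle[OF in_carrier] c(1)]
      by (simp add: norm2_minus_commute[OF in_carrier(2,3)] distrib_left)
    also have "c * norm2 (y - q) \<le> C * norm2 (y - q)"
      using c by (intro mult_right_mono norm2_nonneg)
    finally show ?thesis by simp
  qed
  ultimately show ?case
    by (simp add: ys actions_amortized_alg_Cons cost_Cons distrib_left flip: x_def)
qed

lemma OPT_greatest:
  assumes "x\<^sub>0 \<in> K"
    and "\<And>ys. length ys = length fs \<Longrightarrow> set ys \<subseteq> K \<Longrightarrow> v \<le> cost x\<^sub>0 fs ys"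
  shows "v \<le> OPT K x\<^sub>0 fs"
  unfolding OPT_def
proof (rule cInf_greatest)
  have "length (replicate (length fs) x\<^sub>0) = length fs" "set (replicate (length fs) x\<^sub>0) \<subseteq> K"
    using assms(1) by auto
  then show "{cost x\<^sub>0 fs ys |ys. length ys = length fs \<and> set ys \<subseteq> K} \<noteq> {}" by blast
qed (use assms(2) in auto)

lemma competitive_on_amortized_alg:
  assumes c: "0 \<le> c" "c \<le> C" and C: "C > 0"
    and cfc: "\<And>d K x\<^sub>0 fs. \<I> d K x\<^sub>0 fs \<Longrightarrow> cfc_instance d K x\<^sub>0 fs"
    and step: "\<And>d K x\<^sub>0 fs p f. \<I> d K x\<^sub>0 fs \<Longrightarrow> p \<in> K \<Longrightarrow> f \<in> set fs
      \<Longrightarrow> \<exists>x. amortized_step c C K p f x"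
  shows "competitive_on \<I> C (amortized_alg c C)"
  unfolding competitive_on_def
proof (intro allI impI)
  fix d K x\<^sub>0 fs
  assume inst: "\<I> d K x\<^sub>0 fs"
  then have K: "K \<subseteq> carrier_vec d" and x\<^sub>0: "x\<^sub>0 \<in> K"
    using cfc by (auto simp: cfc_instance_def)
  have "cost x\<^sub>0 fs (actions (amortized_alg c C) d K x\<^sub>0 fs) \<le> C * cost x\<^sub>0 fs ys"
    if "length ys = length fs" "set ys \<subseteq> K" for ys
    using cost_amortized_alg_le[OF K c step[OF inst] x\<^sub>0 x\<^sub>0 that]
      norm2_diff_self[of x\<^sub>0 d] x\<^sub>0 K by auto
  then have "cost x\<^sub>0 fs (actions (amortized_alg c C) d K x\<^sub>0 fs) / C \<le> OPT K x\<^sub>0 fs"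
    using C by (intro OPT_greatest[OF x\<^sub>0]) (simp add: divide_le_eq mult.commute)
  then show "cost x\<^sub>0 fs (actions (amortized_alg c C) d K x\<^sub>0 fs) \<le> C * OPT K x\<^sub>0 fs"
    using C by (simp add: divide_le_eq mult.commute)
qed

lemma competitive_on_well_conditioned:
  assumes \<kappa>: "\<kappa> \<ge> 1"
  shows "competitive_on (well_conditioned_instance \<kappa>) (1296 * sqrt \<kappa>)
    (amortized_alg (108 * sqrt \<kappa>) (1296 * sqrt \<kappa>))"
proof (rule competitive_on_amortized_alg)
  fix d K x\<^sub>0 fs p f
  assume inst: "well_conditioned_instance \<kappa> d K x\<^sub>0 fs" and "p \<in> K" "f \<in> set fs"
  interpret convex_action_set d K
    using inst by unfold_locales (auto simp: well_conditioned_instance_def cfc_instance_def)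
  show "\<exists>x. amortized_step (108 * sqrt \<kappa>) (1296 * sqrt \<kappa>) K p f x"
    using inst \<open>p \<in> K\<close> \<open>f \<in> set fs\<close> \<kappa>
    by (intro amortized_step_exists) (auto simp: well_conditioned_instance_def cfc_instance_def)
qed (use \<kappa> in \<open>simp_all add: well_conditioned_instance_def\<close>)

theorem theorem1:
  shows "\<exists>C::real. C > 0 \<and> (\<forall>\<kappa>::real. \<kappa> \<ge> 1 \<longrightarrow>
    (\<exists>A. online_algorithm A \<and>
      competitive_on (well_conditioned_instance \<kappa>) (C * sqrt \<kappa>) A))"
proof (intro exI[of _ 1296] conjI allI impI)
  fix \<kappa> :: real
  assume "\<kappa> \<ge> 1"
  then show "\<exists>A. online_algorithm A \<and>
      competitive_on (well_conditioned_instance \<kappa>) (1296 * sqrt \<kappa>) A"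
    using online_algorithm_amortized_alg competitive_on_well_conditioned by blast
qed simp

end
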